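(* Let $X$ be a real Banach space and let $x,y\in S_X$. Then: (a) $\rho_+(x,y)=0$ if and only if $(-x)\perp_{B^*}y$. (b) $\rho_-(x,y)=0$ if and only if $x\perp_{B^*}y$.
   Context: $S_X=\{x\in X:\|x\|=1\}$. For $x,y\in X$, $\rho_{\pm}(x,y)=\lim_{\lambda\to 0^{\pm}}\frac{\|x+\lambda y\|-\|x\|}{\lambda}$. Birkhoff-James orthogonality: $x\perp_B y$ means $\|x+\lambda y\|\geq\|x\|$ for all $\lambda\in\mathbb{R}$. For $x,y\in S_X$, $x\perp_{B^*}y$ means that $x\perp_B y$ and, for every $t\in(0,1)$, $x\not\perp_B u$ where $u=ty+(1-t)x$. *)

theory Defs
  imports "HOL-Analysis.Analysis"
begin

text \<open>
  One-sided derivatives of the norm at \<open>x\<close> in the direction \<open>y\<close>. The quotient is monotone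
  in \<open>t\<close> by convexity of the norm, so both limits exist.
\<close>

definition rho_plus :: "'a::real_normed_vector \<Rightarrow> 'a \<Rightarrow> real" where
  "rho_plus x y = Lim (at_right 0) (\<lambda>t::real. (norm (x + t *\<^sub>R y) - norm x) / t)"

definition rho_minus :: "'a::real_normed_vector \<Rightarrow> 'a \<Rightarrow> real" where
  "rho_minus x y = Lim (at_left 0) (\<lambda>t::real. (norm (x + t *\<^sub>R y) - norm x) / t)"

definition BJ_orth :: "'a::real_normed_vector \<Rightarrow> 'a \<Rightarrow> bool"  (infix "\<bottom>\<^sub>B" 50) where
  "x \<bottom>\<^sub>B y \<longleftrightarrow> (\<forall>t::real. norm (x + t *\<^sub>R y) \<ge> norm x)"

text \<open>
  Only meaningful for unit vectors \<open>x\<close> and \<open>y\<close>; the definition does not enforce this.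
\<close>

definition BJ_star_orth :: "'a::real_normed_vector \<Rightarrow> 'a \<Rightarrow> bool"  (infix "\<bottom>\<^sub>B\<^sub>*" 50) where
  "x \<bottom>\<^sub>B\<^sub>* y \<longleftrightarrow>
     x \<bottom>\<^sub>B y \<and> (\<forall>t::real. 0 < t \<and> t < 1 \<longrightarrow> \<not> x \<bottom>\<^sub>B (t *\<^sub>R y + (1 - t) *\<^sub>R x))"

end

theory Submission
  imports Defs
begin

text \<open>
  By convexity of the norm, its difference quotient at \<open>x\<close> along \<open>y\<close> increases as the
  argument rises to \<open>0\<close>, so \<open>rho_minus x y\<close> is the supremum of the quotients at negative arguments, and it is
  nonpositive exactly when moving backwards along \<open>y\<close> never shortens \<open>x\<close>. Reflecting \<open>x\<close> to
  \<open>- x\<close> exchanges the two one-sided derivatives up to sign, so \<open>x \<bottom>\<^sub>B y\<close> amounts to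
  \<open>rho_minus x y \<le> 0 \<le> rho_plus x y\<close> (James's criterion, lemma \<open>BJ_orth_iff_rho\<close>).

  Adding a multiple of the base point to the direction only shifts the one-sided derivatives:
  for \<open>t > 0\<close> and \<open>norm x = 1\<close>, both derivatives \<open>r\<close> along \<open>y\<close> become \<open>t * r + (1 - t)\<close>
  along \<open>t *\<^sub>R y + (1 - t) *\<^sub>R x\<close> (lemmas \<open>rho_minus_shift\<close> and
  \<open>rho_plus_shift\<close>). So when \<open>x \<bottom>\<^sub>B y\<close>, the right
  derivative along every such direction with \<open>0 < t < 1\<close> is positive, and orthogonality can
  fail there only because the left derivative \<open>t * rho_minus x y + (1 - t)\<close> is positive. This
  happens for all \<open>t\<close> in \<open>(0, 1)\<close> exactly when \<open>rho_minus x y \<ge> 0\<close>; together with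
  \<open>rho_minus x y \<le> 0\<close> this is statement (b). Statement (a) is (b) for \<open>- x\<close>.
\<close>

text \<open>
  Convexity of the norm: for \<open>s \<le> t < 0\<close>, the point \<open>x + t *\<^sub>R y\<close> lies on the segment
  from \<open>x\<close> to \<open>x + s *\<^sub>R y\<close>.
\<close>

lemma norm_quotient_mono_left:
  fixes x y :: "'a::real_normed_vector"
  assumes "s \<le> t" "t < 0"
  shows "(norm (x + s *\<^sub>R y) - norm x) / s \<le> (norm (x + t *\<^sub>R y) - norm x) / t"
proof -
  define c where "c = t / s"
  have c: "0 < c" "c \<le> 1" "t = c * s"
    using assms by (auto simp: c_def field_simps divide_neg_neg)
  have "x + t *\<^sub>R y = c *\<^sub>R (x + s *\<^sub>R y) + (1 - c) *\<^sub>R x"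
    by (simp add: c(3) algebra_simps)
  also have "norm \<dots> \<le> c * norm (x + s *\<^sub>R y) + (1 - c) * norm x"
    using norm_triangle_ineq[of "c *\<^sub>R (x + s *\<^sub>R y)" "(1 - c) *\<^sub>R x"] c by simp
  finally have "norm (x + t *\<^sub>R y) - norm x \<le> c * (norm (x + s *\<^sub>R y) - norm x)"
    by (simp add: algebra_simps)
  then have "c * (norm (x + s *\<^sub>R y) - norm x) / t \<le> (norm (x + t *\<^sub>R y) - norm x) / t"
    using assms(2) by (simp add: divide_right_mono_neg)
  moreover have "c * (norm (x + s *\<^sub>R y) - norm x) / t = (norm (x + s *\<^sub>R y) - norm x) / s"
    using c by (simp add: c(3))
  ultimately show ?thesis by simp
qed

lemma norm_quotient_le:
  fixes x y :: "'a::real_normed_vector"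
  assumes "t < 0"
  shows "(norm (x + t *\<^sub>R y) - norm x) / t \<le> norm y"
proof -
  have "norm x \<le> norm (x + t *\<^sub>R y) + norm (t *\<^sub>R y)"
    using norm_triangle_ineq4[of "x + t *\<^sub>R y" "t *\<^sub>R y"] by simp
  then show ?thesis using assms by (simp add: neg_divide_le_eq algebra_simps)
qed

lemma rho_minus_tendsto_Sup:
  fixes x y :: "'a::real_normed_vector"
  shows rho_minus_tendsto:
      "((\<lambda>t. (norm (x + t *\<^sub>R y) - norm x) / t) \<longlongrightarrow> rho_minus x y) (at_left 0)"
    and rho_minus_eq_SUP: "rho_minus x y = (SUP t\<in>{..<0}. (norm (x + t *\<^sub>R y) - norm x) / t)"
proof -
  have *: "((\<lambda>t. (norm (x + t *\<^sub>R y) - norm x) / t) \<longlongrightarrow>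
      (SUP t\<in>{..<0}. (norm (x + t *\<^sub>R y) - norm x) / t)) (at_left 0)"
    using Lim_left_bound[of UNIV 0 "\<lambda>t. (norm (x + t *\<^sub>R y) - norm x) / t" "norm y"]
    by (simp add: norm_quotient_mono_left norm_quotient_le)
  show **: "rho_minus x y = (SUP t\<in>{..<0}. (norm (x + t *\<^sub>R y) - norm x) / t)"
    unfolding rho_minus_def by (rule tendsto_Lim[OF _ *]) simp
  show "((\<lambda>t. (norm (x + t *\<^sub>R y) - norm x) / t) \<longlongrightarrow> rho_minus x y) (at_left 0)"
    using * ** by simp
qed

lemma rho_minus_nonpos_iff:
  fixes x y :: "'a::real_normed_vector"
  shows "rho_minus x y \<le> 0 \<longleftrightarrow> (\<forall>t<0. norm x \<le> norm (x + t *\<^sub>R y))"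
proof -
  have "bdd_above ((\<lambda>t. (norm (x + t *\<^sub>R y) - norm x) / t) ` {..<0})"
    using norm_quotient_le by (auto intro!: bdd_aboveI2)
  then have "rho_minus x y \<le> 0 \<longleftrightarrow> (\<forall>t\<in>{..<0}. (norm (x + t *\<^sub>R y) - norm x) / t \<le> 0)"
    unfolding rho_minus_eq_SUP by (subst cSUP_le_iff) auto
  then show ?thesis by (auto simp: divide_le_0_iff)
qed

text \<open>
  Since \<open>norm (x + t *\<^sub>R y) = norm (- x + (- t) *\<^sub>R y)\<close>, facts about the right derivative
  reduce to facts about the left derivative at the reflected point.
\<close>

lemma rho_plus_tendsto_reflect:
  fixes x y :: "'a::real_normed_vector"
  shows "((\<lambda>t. (norm (x + t *\<^sub>R y) - norm x) / t) \<longlongrightarrow> - rho_minus (- x) y) (at_right 0)"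
proof -
  have reflect: "norm (- x - t *\<^sub>R y) = norm (x + t *\<^sub>R y)" for t
    using norm_minus_cancel[of "x + t *\<^sub>R y"] by simp
  have "((\<lambda>t. - ((norm (x + t *\<^sub>R y) - norm x) / t)) \<longlongrightarrow> rho_minus (- x) y) (at_right 0)"
    using rho_minus_tendsto[of "- x" y] unfolding filterlim_at_left_to_right
    by (simp add: reflect)
  from tendsto_minus[OF this] show ?thesis by simp
qed

lemma rho_plus_eq_reflect: "rho_plus x y = - rho_minus (- x) y"
  unfolding rho_plus_def by (rule tendsto_Lim[OF _ rho_plus_tendsto_reflect]) simp

lemma rho_minus_le_rho_plus: "rho_minus x y \<le> rho_plus x y"
proof (rule tendsto_le)
  show "((\<lambda>t. (norm (x + t *\<^sub>R y) - norm x) / t) \<longlongrightarrow> rho_plus x y) (at_right 0)"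
    using rho_plus_tendsto_reflect[of x y] by (simp add: rho_plus_eq_reflect)
  show "((\<lambda>t. (norm (x + (- t) *\<^sub>R y) - norm x) / (- t)) \<longlongrightarrow> rho_minus x y) (at_right 0)"
    using rho_minus_tendsto[of x y] unfolding filterlim_at_left_to_right by simp
  have "(norm (x + (- t) *\<^sub>R y) - norm x) / (- t) \<le> (norm (x + t *\<^sub>R y) - norm x) / t"
    if "t > 0" for t
  proof -
    \<comment> \<open>\<open>x\<close> is the midpoint of the two points \<open>x \<plusminus> t *\<^sub>R y\<close>.\<close>
    have "norm (2 *\<^sub>R x) \<le> norm (x + t *\<^sub>R y) + norm (x + (- t) *\<^sub>R y)"
      using norm_triangle_ineq[of "x + t *\<^sub>R y" "x + (- t) *\<^sub>R y"] by (simp add: scaleR_2)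
    then have "(norm x - norm (x + (- t) *\<^sub>R y)) / t \<le> (norm (x + t *\<^sub>R y) - norm x) / t"
      using that by (intro divide_right_mono) simp_all
    then show ?thesis by (simp add: diff_divide_distrib)
  qed
  then show "\<forall>\<^sub>F t in at_right 0. (norm (x + (- t) *\<^sub>R y) - norm x) / (- t)
      \<le> (norm (x + t *\<^sub>R y) - norm x) / t"
    by (auto simp: eventually_at_filter)
qed simp

lemma BJ_orth_iff_rho: "x \<bottom>\<^sub>B y \<longleftrightarrow> rho_minus x y \<le> 0 \<and> 0 \<le> rho_plus x y"
proof -
  have reflect: "norm (- x + t *\<^sub>R y) = norm (x + (- t) *\<^sub>R y)" for t
    using norm_minus_cancel[of "x + (- t) *\<^sub>R y"] by simp
  have "x \<bottom>\<^sub>B y \<longleftrightarrow> (\<forall>t<0. norm x \<le> norm (x + t *\<^sub>R y)) \<and> (\<forall>t>0. norm x \<le> norm (x + t *\<^sub>R y))"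
    unfolding BJ_orth_def by (metis add.right_neutral linorder_neqE order_refl scaleR_zero_left)
  also have "(\<forall>t>0. norm x \<le> norm (x + t *\<^sub>R y)) \<longleftrightarrow> (\<forall>t<0. norm (- x) \<le> norm (- x + t *\<^sub>R y))"
    unfolding reflect norm_minus_cancel by (metis neg_0_less_iff_less neg_less_0_iff_less minus_minus)
  finally show ?thesis by (simp add: rho_minus_nonpos_iff rho_plus_eq_reflect)
qed

text \<open>
  For small \<open>t\<close> the point \<open>x + t *\<^sub>R (a *\<^sub>R y + b *\<^sub>R x)\<close> is a positive multiple \<open>1 + t * b\<close> of
  \<open>x + m *\<^sub>R y\<close>, where \<open>m = t * a / (1 + t * b)\<close> tends to \<open>0\<close> with the sign of \<open>t\<close>. So the
  quotient at \<open>t\<close> is \<open>a\<close> times the quotient along \<open>y\<close> at \<open>m\<close>, plus \<open>b * norm x\<close>.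
\<close>

lemma rho_minus_shift:
  fixes x y :: "'a::real_normed_vector"
  assumes "a > 0"
  shows "rho_minus x (a *\<^sub>R y + b *\<^sub>R x) = a * rho_minus x y + b * norm x"
proof -
  define m where "m = (\<lambda>t::real. t * a / (1 + t * b))"
  have "((\<lambda>t. 1 + t * b) \<longlongrightarrow> 1 + 0 * b) (at_left 0)"
    by (intro tendsto_intros)
  then have pos: "\<forall>\<^sub>F t in at_left 0. 1 + t * b > 0"
    by (rule order_tendstoD) simp
  have neg: "\<forall>\<^sub>F t in at_left (0::real). t < 0"
    by (simp add: eventually_at_filter)
  have "(m \<longlongrightarrow> 0 * a / (1 + 0 * b)) (at_left 0)"
    unfolding m_def by (intro tendsto_intros) simp
  moreover have "\<forall>\<^sub>F t in at_left 0. m t < 0"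
    using pos neg by eventually_elim (use assms in \<open>simp add: m_def divide_neg_pos mult_neg_pos\<close>)
  ultimately have m_left: "filterlim m (at_left 0) (at_left 0)"
    by (auto simp: filterlim_at elim: eventually_mono)
  have "((\<lambda>t. a * ((norm (x + m t *\<^sub>R y) - norm x) / m t) + b * norm x)
      \<longlongrightarrow> a * rho_minus x y + b * norm x) (at_left 0)"
    by (intro tendsto_intros filterlim_compose[OF rho_minus_tendsto m_left])
  moreover have "\<forall>\<^sub>F t in at_left 0.
      a * ((norm (x + m t *\<^sub>R y) - norm x) / m t) + b * norm x
      = (norm (x + t *\<^sub>R (a *\<^sub>R y + b *\<^sub>R x)) - norm x) / t"
    using pos neg
  proof eventually_elim
    case (elim t)
    have mt: "(1 + t * b) * m t = t * a"
      using elim by (simp add: m_def)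
    have "x + t *\<^sub>R (a *\<^sub>R y + b *\<^sub>R x) = (1 + t * b) *\<^sub>R x + ((1 + t * b) * m t) *\<^sub>R y"
      unfolding mt by (simp add: algebra_simps)
    also have "\<dots> = (1 + t * b) *\<^sub>R (x + m t *\<^sub>R y)"
      by (simp add: scaleR_add_right)
    finally have "norm (x + t *\<^sub>R (a *\<^sub>R y + b *\<^sub>R x)) = (1 + t * b) * norm (x + m t *\<^sub>R y)"
      using elim by simp
    moreover have "a * ((norm (x + m t *\<^sub>R y) - norm x) / m t)
        = (1 + t * b) * (norm (x + m t *\<^sub>R y) - norm x) / t"
      using elim assms by (simp add: m_def)
    moreover have "(1 + t * b) * (n - k) / t + b * k = ((1 + t * b) * n - k) / t" for n k :: real
      using elim by (simp add: field_simps)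
    ultimately show ?case by simp
  qed
  ultimately have "((\<lambda>t. (norm (x + t *\<^sub>R (a *\<^sub>R y + b *\<^sub>R x)) - norm x) / t)
      \<longlongrightarrow> a * rho_minus x y + b * norm x) (at_left 0)"
    by (rule Lim_transform_eventually)
  then show ?thesis
    unfolding rho_minus_def[of x "a *\<^sub>R y + b *\<^sub>R x"] by (intro tendsto_Lim) simp_all
qed

lemma rho_plus_shift:
  fixes x y :: "'a::real_normed_vector"
  assumes "a > 0"
  shows "rho_plus x (a *\<^sub>R y + b *\<^sub>R x) = a * rho_plus x y + b * norm x"
  using rho_minus_shift[OF assms, of "- x" y "- b"] by (simp add: rho_plus_eq_reflect)

lemma rho_minus_eq_0_iff_BJ_star_orth:
  fixes x y :: "'a::real_normed_vector"
  assumes "norm x = 1"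
  shows "rho_minus x y = 0 \<longleftrightarrow> x \<bottom>\<^sub>B\<^sub>* y"
proof
  assume zero: "rho_minus x y = 0"
  then have "x \<bottom>\<^sub>B y"
    using rho_minus_le_rho_plus[of x y] by (simp add: BJ_orth_iff_rho)
  with zero show "x \<bottom>\<^sub>B\<^sub>* y"
    by (auto simp: BJ_star_orth_def BJ_orth_iff_rho[of x "_ + _"] rho_minus_shift assms)
next
  assume star: "x \<bottom>\<^sub>B\<^sub>* y"
  then have nonpos: "rho_minus x y \<le> 0" and nonneg: "0 \<le> rho_plus x y"
    by (auto simp: BJ_star_orth_def BJ_orth_iff_rho)
  show "rho_minus x y = 0"
  proof (rule ccontr)
    assume "rho_minus x y \<noteq> 0"
    with nonpos have less: "rho_minus x y < 0" by simp
    \<comment> \<open>The value of \<open>t\<close> at which the left derivative \<open>t * rho_minus x y + (1 - t)\<close> vanishes.\<close>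
    define t where "t = 1 / (1 - rho_minus x y)"
    have t: "0 < t" "t < 1" using less by (auto simp: t_def)
    have "t * (1 - rho_minus x y) = 1" using less by (simp add: t_def)
    then have "rho_minus x (t *\<^sub>R y + (1 - t) *\<^sub>R x) = 0"
      unfolding rho_minus_shift[OF t(1)] using assms by (simp add: algebra_simps)
    moreover have "0 \<le> rho_plus x (t *\<^sub>R y + (1 - t) *\<^sub>R x)"
      using t nonneg assms by (simp add: rho_plus_shift)
    ultimately have "x \<bottom>\<^sub>B (t *\<^sub>R y + (1 - t) *\<^sub>R x)"
      by (simp add: BJ_orth_iff_rho)
    with star t show False by (simp add: BJ_star_orth_def)
  qed
qed

theorem theorem2p8:
  fixes x y :: "'a::banach"
  assumes "x \<in> sphere 0 1" and "y \<in> sphere 0 1"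
  shows "(rho_plus x y = 0 \<longleftrightarrow> (- x) \<bottom>\<^sub>B\<^sub>* y) \<and>
         (rho_minus x y = 0 \<longleftrightarrow> x \<bottom>\<^sub>B\<^sub>* y)"
  using assms(1) rho_minus_eq_0_iff_BJ_star_orth[of x y] rho_minus_eq_0_iff_BJ_star_orth[of "- x" y]
  by (simp add: rho_plus_eq_reflect)

end
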